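(* For a linear map $\Omega:\mathbb{F}[x]\to\mathbb{F}[x]$ let $\psi_3:\mathbb{F}[x]\times H_3\to\mathbb{F}[x]$ be the bilinear map with $\psi_3(p,\overline{1})=p$, $\psi_3(p,\overline{x})=xp$, $\psi_3(p,\frac{\overline{\delta}}{\delta x})=\Omega(p)$. Suppose $\psi_3$ makes $\mathbb{F}[x]$ an $H_3$-module, and let $L$ be a Leibniz algebra with $L/I\cong H_3$ and such that the $H_3$-module $I$ is isomorphic to $(\mathbb{F}[x],\psi_3)$. Then $L$ admits a basis $\{\overline{1},\overline{x},\frac{\overline{\delta}}{\delta x}\}\,\dot\cup\,\{x^i:i\in\mathbb{N}\cup\{0\}\}$ in which the multiplication table is $$[x^i,\overline{1}]=x^i,\quad [x^i,\overline{x}]=x^{i+1},\quad [x^i,\tfrac{\overline{\delta}}{\delta x}]=\Omega(x^i),\quad [\overline{x},\tfrac{\overline{\delta}}{\delta x}]=\overline{1},\quad [\tfrac{\overline{\delta}}{\delta x},\overline{x}]=-\overline{1},$$ where all omitted products of basis elements are zero and $\Omega$ satisfies $$\Omega(x^i)=i\,x^{i-1}+x^ic(x)\qquad (i\in\mathbb{N}\cup\{0\})$$ for some fixed $c(x)\in\mathbb{F}[x]$.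
   Context: $\mathbb{F}$ is an algebraically closed field of characteristic zero. A Leibniz algebra is an $\mathbb{F}$-vector space $L$ with a bilinear product $[\cdot,\cdot]$ satisfying $[[y,z],x]=[[y,x],z]+[y,[z,x]]$ for all $x,y,z\in L$. $I$ denotes the ideal of $L$ generated by $\{[x,x]:x\in L\}$; it satisfies $[L,I]=0$, the quotient $L/I$ is a Lie algebra, and $I$ is a (right) $L/I$-module via $(i,[x])\mapsto [i,x]$. A (right) module $M$ over a Lie algebra $\mathfrak g$ satisfies $m\cdot[a,b]=(m\cdot a)\cdot b-(m\cdot b)\cdot a$. $H_3$ is the Heisenberg Lie algebra with basis $\{\overline{1},\overline{x},\frac{\overline{\delta}}{\delta x}\}$ and nonzero products $[\overline{x},\frac{\overline{\delta}}{\delta x}]=-[\frac{\overline{\delta}}{\delta x},\overline{x}]=\overline{1}$. In the table, $\Omega(x^i)$ is expanded linearly in the basis elements $x^j$ of $I$; for $i=0$ the term $i\,x^{i-1}$ is zero. *)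

theory Defs
  imports "HOL-Computational_Algebra.Polynomial"
begin

definition bilinear_map ::
  "('k::field \<Rightarrow> 'a::ab_group_add \<Rightarrow> 'a) \<Rightarrow> ('k \<Rightarrow> 'b::ab_group_add \<Rightarrow> 'b) \<Rightarrow>
   ('k \<Rightarrow> 'c::ab_group_add \<Rightarrow> 'c) \<Rightarrow> ('a \<Rightarrow> 'b \<Rightarrow> 'c) \<Rightarrow> bool"
  where "bilinear_map s1 s2 s3 f \<longleftrightarrow>
    (\<forall>x. Vector_Spaces.linear s2 s3 (f x)) \<and> (\<forall>y. Vector_Spaces.linear s1 s3 (\<lambda>x. f x y))"

locale lie_algebra = vector_space scale
  for scale :: "'k::field \<Rightarrow> 'a::ab_group_add \<Rightarrow> 'a" +
  fixes br :: "'a \<Rightarrow> 'a \<Rightarrow> 'a"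
  assumes br_bilinear: "bilinear_map scale scale scale br"
    and br_alternating: "br x x = 0"
    and br_jacobi: "br x (br y z) + br y (br z x) + br z (br x y) = 0"

locale heisenberg_algebra = lie_algebra scale br
  for scale :: "'k::field \<Rightarrow> 'a::ab_group_add \<Rightarrow> 'a" and br :: "'a \<Rightarrow> 'a \<Rightarrow> 'a" +
  fixes h1 hx hd :: 'a
  assumes basis_distinct: "distinct [h1, hx, hd]"
    and basis_independent: "independent {h1, hx, hd}"
    and basis_span: "span {h1, hx, hd} = UNIV"
    and br_hx_hd: "br hx hd = h1"
    and br_hd_hx: "br hd hx = - h1"
    and br_zero: "br h1 h1 = 0" "br h1 hx = 0" "br h1 hd = 0" "br hx h1 = 0" "br hx hx = 0"
      "br hd h1 = 0" "br hd hd = 0"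

locale lie_module = lie_algebra scale br
  for scale :: "'k::field \<Rightarrow> 'a::ab_group_add \<Rightarrow> 'a" and br :: "'a \<Rightarrow> 'a \<Rightarrow> 'a" +
  fixes scaleM :: "'k \<Rightarrow> 'm::ab_group_add \<Rightarrow> 'm" and act :: "'m \<Rightarrow> 'a \<Rightarrow> 'm"
  assumes act_bilinear: "bilinear_map scaleM scale scaleM act"
    and act_br: "act m (br a b) = act (act m a) b - act (act m b) a"

locale leibniz_algebra = vector_space scale
  for scale :: "'k::field \<Rightarrow> 'a::ab_group_add \<Rightarrow> 'a" +
  fixes br :: "'a \<Rightarrow> 'a \<Rightarrow> 'a"
  assumes br_bilinear: "bilinear_map scale scale scale br"
    and leibniz: "br (br y z) x = br (br y x) z + br y (br z x)"
begin

definition is_ideal :: "'a set \<Rightarrow> bool"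
  where "is_ideal J \<longleftrightarrow> subspace J \<and> (\<forall>j\<in>J. \<forall>x. br j x \<in> J \<and> br x j \<in> J)"

definition leib :: "'a set"
  where "leib = is_ideal hull (range (\<lambda>x. br x x))"

definition cls :: "'a \<Rightarrow> 'a set"
  where "cls x = {y. y - x \<in> leib}"

definition quot :: "'a set set"
  where "quot = range cls"

text \<open>The operations on \<open>L/I\<close>, and the action of \<open>L/I\<close> on \<open>I\<close>, are computed on representatives;
  independence of the choice is shown below.\<close>

definition rep :: "'a set \<Rightarrow> 'a"
  where "rep A = (SOME x. x \<in> A)"

definition quot_add :: "'a set \<Rightarrow> 'a set \<Rightarrow> 'a set"
  where "quot_add A B = cls (rep A + rep B)"

definition quot_scale :: "'k \<Rightarrow> 'a set \<Rightarrow> 'a set"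
  where "quot_scale c A = cls (scale c (rep A))"

definition quot_br :: "'a set \<Rightarrow> 'a set \<Rightarrow> 'a set"
  where "quot_br A B = cls (br (rep A) (rep B))"

definition leib_act :: "'a \<Rightarrow> 'a set \<Rightarrow> 'a"
  where "leib_act i A = br i (rep A)"

definition quot_iso ::
  "('k \<Rightarrow> 'b::ab_group_add \<Rightarrow> 'b) \<Rightarrow> ('b \<Rightarrow> 'b \<Rightarrow> 'b) \<Rightarrow> ('a set \<Rightarrow> 'b) \<Rightarrow> bool"
  where "quot_iso scaleH brH \<phi> \<longleftrightarrow>
    bij_betw \<phi> quot UNIV \<and>
    (\<forall>A\<in>quot. \<forall>B\<in>quot. \<phi> (quot_add A B) = \<phi> A + \<phi> B) \<and>
    (\<forall>c. \<forall>A\<in>quot. \<phi> (quot_scale c A) = scaleH c (\<phi> A)) \<and>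
    (\<forall>A\<in>quot. \<forall>B\<in>quot. \<phi> (quot_br A B) = brH (\<phi> A) (\<phi> B))"

text \<open>Given \<open>\<phi> : L/I \<cong> H\<close>, the ideal \<open>I\<close> is an \<open>H\<close>-module by transporting \<open>leib_act\<close> along
  \<open>\<phi>\<close>; \<open>\<theta>\<close> is an isomorphism from it onto the \<open>H\<close>-module \<open>M\<close>.\<close>

definition leib_module_iso ::
  "('a set \<Rightarrow> 'b) \<Rightarrow> ('k \<Rightarrow> 'm::ab_group_add \<Rightarrow> 'm) \<Rightarrow> ('m \<Rightarrow> 'b \<Rightarrow> 'm) \<Rightarrow> ('a \<Rightarrow> 'm) \<Rightarrow> bool"
  where "leib_module_iso \<phi> scaleM act \<theta> \<longleftrightarrow>
    bij_betw \<theta> leib UNIV \<and>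
    (\<forall>i\<in>leib. \<forall>j\<in>leib. \<theta> (i + j) = \<theta> i + \<theta> j) \<and>
    (\<forall>c. \<forall>i\<in>leib. \<theta> (scale c i) = scaleM c (\<theta> i)) \<and>
    (\<forall>i\<in>leib. \<forall>h. \<theta> (leib_act i (the_inv_into quot \<phi> h)) = act (\<theta> i) h)"

lemma br_add_left: "br (x + y) z = br x z + br y z"
  and br_add_right: "br x (y + z) = br x y + br x z"
  and br_scale_left: "br (scale c x) y = scale c (br x y)"
  and br_scale_right: "br x (scale c y) = scale c (br x y)"
  using br_bilinear unfolding bilinear_map_def Vector_Spaces.linear_def
    module_hom_def module_hom_axioms_def by metis+

lemma br_0_right: "br x 0 = 0" and br_0_left: "br 0 x = 0"
  using br_add_right[of x 0 0] br_add_left[of 0 0 x] by auto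

lemma is_ideal_leib: "is_ideal leib"
  unfolding leib_def
  by (rule hull_in) (auto simp: is_ideal_def intro: subspace_Inter)

lemma square_in_leib: "br x x \<in> leib"
  unfolding leib_def using hull_subset[of "range (\<lambda>x. br x x)" is_ideal] by blast

lemma br_leib_right:
  assumes "i \<in> leib" shows "br x i = 0"
proof -
  define Z where "Z = {i. \<forall>y. br y i = 0}"
  have "is_ideal Z"
  proof -
    have "br y (br i x) = 0" if "i \<in> Z" for i x y
      using leibniz[of y i x] that by (simp add: Z_def br_0_left)
    then show ?thesis
      by (auto simp: is_ideal_def Z_def subspace_def br_0_right br_add_right br_scale_right)
  qed
  moreover have "range (\<lambda>x. br x x) \<subseteq> Z"
    using leibniz[of _ x x for x] by (auto simp: Z_def)
  ultimately have "leib \<subseteq> Z"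
    unfolding leib_def by (rule hull_minimal[rotated])
  then show ?thesis using assms by (auto simp: Z_def)
qed

lemma rep_cls: "rep (cls x) - x \<in> leib"
proof -
  have "x \<in> cls x"
    using is_ideal_leib by (auto simp: cls_def is_ideal_def intro: subspace_0)
  then have "rep (cls x) \<in> cls x" unfolding rep_def by (rule someI)
  then show ?thesis by (simp add: cls_def)
qed

lemma cls_eqI:
  assumes "x - y \<in> leib" shows "cls x = cls y"
proof -
  have S: "subspace leib" using is_ideal_leib by (simp add: is_ideal_def)
  have "z - x \<in> leib \<longleftrightarrow> z - y \<in> leib" for z
    using subspace_add[OF S assms, of "z - x"] subspace_diff[OF S _ assms, of "z - y"]
    by (auto simp: algebra_simps)
  then show ?thesis by (auto simp: cls_def)
qed

lemma quot_add_cls: "quot_add (cls x) (cls y) = cls (x + y)"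
proof -
  have "(rep (cls x) - x) + (rep (cls y) - y) \<in> leib"
    using is_ideal_leib rep_cls by (auto simp: is_ideal_def intro: subspace_add)
  then show ?thesis unfolding quot_add_def by (intro cls_eqI) (simp add: algebra_simps)
qed

lemma quot_scale_cls: "quot_scale c (cls x) = cls (scale c x)"
proof -
  have "scale c (rep (cls x) - x) \<in> leib"
    using is_ideal_leib rep_cls by (auto simp: is_ideal_def intro: subspace_scale)
  then show ?thesis
    unfolding quot_scale_def by (intro cls_eqI) (simp add: scale_right_diff_distrib)
qed

lemma quot_br_cls: "quot_br (cls x) (cls y) = cls (br x y)"
proof -
  define i j where "i = rep (cls x) - x" and "j = rep (cls y) - y"
  have i: "i \<in> leib" and j: "j \<in> leib" by (simp_all add: i_def j_def rep_cls)
  have r: "rep (cls x) = x + i" "rep (cls y) = y + j" by (simp_all add: i_def j_def)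
  have "br (rep (cls x)) (rep (cls y)) - br x y = br i y"
    by (simp add: r br_add_left br_add_right br_leib_right[OF j])
  also have "\<dots> \<in> leib" using i is_ideal_leib by (auto simp: is_ideal_def)
  finally show ?thesis unfolding quot_br_def by (rule cls_eqI)
qed

lemma leib_act_cls: "leib_act i (cls x) = br i x"
  using br_add_right[of i x "rep (cls x) - x"] br_leib_right[OF rep_cls]
  by (simp add: leib_act_def)

end

end

theory Submission
  imports Defs
begin

text \<open>The central generator of \<open>H\<^sub>3\<close> acts on \<open>I\<close> as the identity, and it has a lift \<open>e\<close> with
  \<open>[e, e] = 0\<close>. Right multiplication by \<open>e\<close> is a derivation, so its kernel \<open>K\<close> is a subalgebra;
  \<open>K \<inter> I = 0\<close>, and \<open>x - [x, e]\<close> lies in \<open>K\<close> whenever \<open>[x, e] \<in> I\<close>. Hence \<open>K\<close> is a complement of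
  \<open>I\<close> isomorphic to \<open>H\<^sub>3\<close>. The formula for \<open>\<Omega>\<close> comes from the module identity
  \<open>\<Omega>(x p) = x \<Omega>(p) + p\<close>, with \<open>c = \<Omega>(1)\<close>.\<close>

section \<open>Right multiplication, the quotient map and the module isomorphism\<close>

context leibniz_algebra
begin

lemma subspace_leib: "subspace leib"
  using is_ideal_leib by (simp add: is_ideal_def)

lemma br_leib_left: "i \<in> leib \<Longrightarrow> br i x \<in> leib"
  using is_ideal_leib by (simp add: is_ideal_def)

lemma br_diff_left: "br (x - y) z = br x z - br y z"
  using br_add_left[of "x - y" y z] by (simp add: algebra_simps)

lemma br_diff_right: "br x (y - z) = br x y - br x z"
  using br_add_right[of x "y - z" z] by (simp add: algebra_simps)

lemma br_annihilated_closed: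
  assumes "br y e = 0" and "br z e = 0"
  shows "br (br y z) e = 0"
  using leibniz[of y z e] assms by (simp add: br_0_left br_0_right)

text \<open>Right multiplication by \<open>e\<close> is both the identity and zero on
  \<open>u - v\<close>. This reduces an equation between elements killed by \<open>e\<close> to a
  comparison modulo \<open>leib\<close>.\<close>

lemma annihilated_eqI:
  assumes "\<And>i. i \<in> leib \<Longrightarrow> br i e = i"
    and "br u e = 0" and "br v e = 0" and "u - v \<in> leib"
  shows "u = v"
  using assms(1)[OF assms(4)] assms(2,3) by (simp add: br_diff_left)

context
  fixes scaleH :: "'k \<Rightarrow> 'h::ab_group_add \<Rightarrow> 'h" and brH and \<phi>
  assumes iso: "quot_iso scaleH brH \<phi>"
begin

lemma quot_iso_cls_add: "\<phi> (cls (x + y)) = \<phi> (cls x) + \<phi> (cls y)"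
  using iso by (auto simp: quot_iso_def quot_def simp flip: quot_add_cls)

lemma quot_iso_cls_scale: "\<phi> (cls (scale c x)) = scaleH c (\<phi> (cls x))"
  using iso by (auto simp: quot_iso_def quot_def simp flip: quot_scale_cls)

lemma quot_iso_cls_br: "\<phi> (cls (br x y)) = brH (\<phi> (cls x)) (\<phi> (cls y))"
  using iso by (auto simp: quot_iso_def quot_def simp flip: quot_br_cls)

lemma quot_iso_cls_diff: "\<phi> (cls (x - y)) = \<phi> (cls x) - \<phi> (cls y)"
  using quot_iso_cls_add[of "x - y" y] by (simp add: algebra_simps)

lemma quot_iso_cls_0: "\<phi> (cls 0) = 0"
  using quot_iso_cls_add[of 0 0] by simp

lemma quot_iso_cls_eq_iff: "\<phi> (cls x) = \<phi> (cls y) \<longleftrightarrow> x - y \<in> leib"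
proof
  assume "\<phi> (cls x) = \<phi> (cls y)"
  moreover have "inj_on \<phi> quot"
    using iso by (auto simp: quot_iso_def bij_betw_def)
  ultimately have "cls x = cls y"
    by (auto simp: quot_def dest: inj_onD)
  moreover have "x \<in> cls x"
    using subspace_0[OF subspace_leib] by (simp add: cls_def)
  ultimately show "x - y \<in> leib"
    by (simp add: cls_def)
next
  assume "x - y \<in> leib"
  then show "\<phi> (cls x) = \<phi> (cls y)"
    by (simp add: cls_eqI)
qed

lemma quot_iso_cls_eq_0_iff: "\<phi> (cls x) = 0 \<longleftrightarrow> x \<in> leib"
  using quot_iso_cls_eq_iff[of x 0] by (simp add: quot_iso_cls_0)

lemma quot_iso_cls_surj: "\<exists>x. \<phi> (cls x) = h"
proof -
  have "h \<in> \<phi> ` quot"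
    using iso by (auto simp: quot_iso_def bij_betw_def)
  then show ?thesis
    by (auto simp: quot_def)
qed

lemma the_inv_into_quot_iso_cls: "the_inv_into quot \<phi> (\<phi> (cls x)) = cls x"
  using iso by (intro the_inv_into_f_f) (auto simp: quot_iso_def bij_betw_def quot_def)

text \<open>\<open>\<theta>\<close> is constrained only on \<open>leib\<close>, whereas its inverse
  \<open>T\<close> is linear on the whole module, so general results on injective linear maps apply
  to it. Phrasing the action through \<open>\<phi> (cls x)\<close> removes
  \<open>the_inv_into\<close> from later computations.\<close>

lemma leib_module_iso_inverse:
  fixes scaleM :: "'k \<Rightarrow> 'm::ab_group_add \<Rightarrow> 'm"
  assumes \<theta>: "leib_module_iso \<phi> scaleM act \<theta>" and M: "vector_space scaleM"
  obtains T where "Vector_Spaces.linear scaleM scale T" and "inj T" and "range T = leib"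
    and "\<And>m x. br (T m) x = T (act m (\<phi> (cls x)))"
proof
  define T where "T = the_inv_into leib \<theta>"
  have bij: "bij_betw \<theta> leib UNIV"
    and add: "\<And>i j. i \<in> leib \<Longrightarrow> j \<in> leib \<Longrightarrow> \<theta> (i + j) = \<theta> i + \<theta> j"
    and scale: "\<And>c i. i \<in> leib \<Longrightarrow> \<theta> (scale c i) = scaleM c (\<theta> i)"
    and act: "\<And>i h. i \<in> leib \<Longrightarrow> \<theta> (leib_act i (the_inv_into quot \<phi> h)) = act (\<theta> i) h"
    using \<theta> by (auto simp: leib_module_iso_def)
  have bijT: "bij_betw T UNIV leib"
    using bij unfolding T_def by (rule bij_betw_the_inv_into)
  then show "inj T" and rT: "range T = leib"
    by (auto simp: bij_betw_def)
  have Tin [simp]: "T m \<in> leib" for m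
    using rT by auto
  have \<theta>T [simp]: "\<theta> (T m) = m" for m
    using bij unfolding T_def by (auto simp: bij_betw_def f_the_inv_into_f)
  have T\<theta>: "T (\<theta> i) = i" if "i \<in> leib" for i
    using bij that unfolding T_def by (auto simp: bij_betw_def the_inv_into_f_f)
  have T_add: "T (m + n) = T m + T n" for m n
    using T\<theta>[of "T m + T n"] add[of "T m" "T n"] subspace_add[OF subspace_leib, of "T m" "T n"]
    by simp
  have T_scale: "T (scaleM c m) = scale c (T m)" for c m
    using T\<theta>[of "scale c (T m)"] scale[of "T m" c] subspace_scale[OF subspace_leib, of "T m" c]
    by simp
  show "Vector_Spaces.linear scaleM scale T"
    using M vector_space_axioms T_add T_scale
    by (simp add: Vector_Spaces.linear_iff)
  show "br (T m) x = T (act m (\<phi> (cls x)))" for m x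
    using act[of "T m" "\<phi> (cls x)"] T\<theta>[of "br (T m) x"]
    by (simp add: the_inv_into_quot_iso_cls leib_act_cls br_leib_left)
qed

end

end

section \<open>The monomial basis and operators with commutator one\<close>

lemma vector_space_smult: "vector_space (smult :: 'a::field \<Rightarrow> 'a poly \<Rightarrow> 'a poly)"
  by unfold_locales (simp_all add: smult_add_right smult_add_left)

lemma inj_monom_one: "inj (\<lambda>i. monom (1::'a::zero_neq_one) i)"
  by (auto simp: inj_def monom_eq_iff')

lemma span_monoms: "module.span smult (range (\<lambda>i. monom (1::'a::field) i)) = UNIV"
proof -
  interpret vector_space "smult :: 'a \<Rightarrow> 'a poly \<Rightarrow> 'a poly"
    by (rule vector_space_smult)
  have "p \<in> span (range (monom 1))" for p :: "'a poly"
  proof -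
    have "(\<Sum>i\<le>degree p. smult (coeff p i) (monom 1 i)) \<in> span (range (monom 1))"
      by (intro span_sum span_scale span_base) auto
    then show ?thesis
      by (simp add: smult_monom poly_as_sum_of_monoms)
  qed
  then show ?thesis by auto
qed

lemma independent_monoms: "\<not> module.dependent smult (range (\<lambda>i. monom (1::'a::field) i))"
proof -
  interpret vector_space "smult :: 'a \<Rightarrow> 'a poly \<Rightarrow> 'a poly"
    by (rule vector_space_smult)
  have "u (monom 1 i) = 0"
    if S: "finite S" "S \<subseteq> range (monom 1)" "monom 1 i \<in> S"
      and z: "(\<Sum>v\<in>S. smult (u v) v) = 0" for S i and u :: "'a poly \<Rightarrow> 'a"
  proof -
    have "0 = (\<Sum>v\<in>S. u v * coeff v i)"
      using arg_cong[OF z, of "\<lambda>p. coeff p i"] by (simp add: coeff_sum)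
    \<comment> \<open>All elements of \<open>S\<close> are monic monomials, so only
      \<open>monom 1 i\<close> has a nonzero coefficient at \<open>i\<close>.\<close>
    also have "\<dots> = (\<Sum>v\<in>S. if v = monom 1 i then u v else 0)"
      using S(2) by (intro sum.cong) (auto simp: monom_eq_iff')
    also have "\<dots> = u (monom 1 i)"
      using S by simp
    finally show ?thesis by simp
  qed
  then show ?thesis
    unfolding dependent_explicit by blast
qed

text \<open>By hypothesis \<open>D\<close> has commutator one with multiplication by the variable,
  as formal differentiation has. Their difference therefore commutes with that multiplication and
  sends \<open>monom 1 i\<close> to \<open>monom 1 i * D 1\<close>; the induction carries this out
  degree by degree.\<close>

lemma commutator_one_on_monoms:
  fixes D :: "'a::comm_ring_1 poly \<Rightarrow> 'a poly"
  assumes "\<And>p. D ([:0, 1:] * p) = [:0, 1:] * D p + p"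
  shows "D (monom 1 i) = smult (of_nat i) (monom 1 (i - 1)) + monom 1 i * D 1"
proof (induction i)
  case (Suc i)
  have x: "[:0, 1:] * monom 1 j = monom (1::'a) (Suc j)" for j
    by (simp add: monom_Suc)
  \<comment> \<open>For \<open>i = 0\<close> the truncated exponent \<open>i - 1\<close> is again
    \<open>0\<close>, and the factor \<open>of_nat i\<close> makes both sides vanish.\<close>
  have "smult (of_nat i) (monom 1 i) = [:0, 1:] * smult (of_nat i) (monom (1::'a) (i - 1))"
    by (cases i) (simp_all only: mult_smult_right x, simp_all)
  then show ?case
    using assms[of "monom 1 i"] unfolding x Suc.IH
    by (simp only: ring_distribs mult.assoc[symmetric] x) (simp add: smult_add_left)
qed simp

section \<open>Coordinates in the Heisenberg algebra\<close>

context heisenberg_algebra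
begin

lemma basis_coordinates: "\<exists>a b c. h = scale a h1 + scale b hx + scale c hd"
proof -
  have "h \<in> span {h1, hx, hd}"
    by (simp add: basis_span)
  then obtain a b c where "h - scale a h1 - scale b hx - scale c hd = 0"
    by (auto simp: span_breakdown_eq)
  then show ?thesis
    by (metis add.assoc add.commute diff_add_cancel diff_diff_eq eq_iff_diff_eq_0)
qed

text \<open>Independence is unfolded in the order \<open>hd\<close>, \<open>hx\<close>,
  \<open>h1\<close>, the order in which their lifts are later adjoined to a basis of the
  ideal.\<close>

lemma basis_not_in_span: "hd \<noteq> 0" "hx \<noteq> scale a hd" "h1 \<noteq> scale a hx + scale b hd"
proof -
  have ind: "independent (insert h1 (insert hx (insert hd {})))"
    using basis_independent by simp
  then have "h1 \<notin> span {hx, hd}" "hx \<notin> span {hd}" "hd \<notin> span {}"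
    using basis_distinct by (auto simp only: independent_insert distinct.simps list.set split: if_splits)
  then show "hd \<noteq> 0" "hx \<noteq> scale a hd" "h1 \<noteq> scale a hx + scale b hd"
    by (auto simp: span_breakdown_eq algebra_simps)
qed

end

theorem proposition5:
  fixes scaleH :: "'k::{alg_closed_field,field_char_0} \<Rightarrow> 'h::ab_group_add \<Rightarrow> 'h"
    and brH :: "'h \<Rightarrow> 'h \<Rightarrow> 'h"
    and h1 hx hd :: 'h
    and \<Omega> :: "'k poly \<Rightarrow> 'k poly"
    and \<psi> :: "'k poly \<Rightarrow> 'h \<Rightarrow> 'k poly"
    and scaleL :: "'k \<Rightarrow> 'l::ab_group_add \<Rightarrow> 'l"
    and brL :: "'l \<Rightarrow> 'l \<Rightarrow> 'l"
    and \<phi> :: "'l set \<Rightarrow> 'h"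
    and \<theta> :: "'l \<Rightarrow> 'k poly"
  assumes "heisenberg_algebra scaleH brH h1 hx hd"
    and "Vector_Spaces.linear smult smult \<Omega>"
    and "bilinear_map smult scaleH smult \<psi>"
    and "\<And>p. \<psi> p h1 = p"
    and "\<And>p. \<psi> p hx = [:0, 1:] * p"
    and "\<And>p. \<psi> p hd = \<Omega> p"
    and "lie_module scaleH brH smult \<psi>"
    and "leibniz_algebra scaleL brL"
    and "leibniz_algebra.quot_iso scaleL brL scaleH brH \<phi>"
    and "leibniz_algebra.leib_module_iso scaleL brL \<phi> smult \<psi> \<theta>"
  shows "\<exists>(e1 :: 'l) (ex :: 'l) (ed :: 'l) (X :: nat \<Rightarrow> 'l).
    distinct [e1, ex, ed] \<and> inj X \<and> {e1, ex, ed} \<inter> range X = {} \<and>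
    \<not> module.dependent scaleL ({e1, ex, ed} \<union> range X) \<and>
    module.span scaleL ({e1, ex, ed} \<union> range X) = UNIV \<and>
    module.span scaleL (range X) = leibniz_algebra.leib scaleL brL \<and>
    (\<forall>i. brL (X i) e1 = X i) \<and>
    (\<forall>i. brL (X i) ex = X (i + 1)) \<and>
    (\<forall>i. brL (X i) ed =
          (\<Sum>j\<le>degree (\<Omega> (monom 1 i)). scaleL (coeff (\<Omega> (monom 1 i)) j) (X j))) \<and>
    brL ex ed = e1 \<and> brL ed ex = - e1 \<and>
    brL e1 e1 = 0 \<and> brL e1 ex = 0 \<and> brL e1 ed = 0 \<and>
    brL ex e1 = 0 \<and> brL ex ex = 0 \<and> brL ed e1 = 0 \<and> brL ed ed = 0 \<and>
    (\<forall>i. brL e1 (X i) = 0 \<and> brL ex (X i) = 0 \<and> brL ed (X i) = 0) \<and>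
    (\<forall>i j. brL (X i) (X j) = 0) \<and>
    (\<exists>c :: 'k poly. \<forall>i.
       \<Omega> (monom 1 i) = smult (of_nat i) (monom 1 (i - 1)) + monom 1 i * c)"
proof -
  interpret H: heisenberg_algebra scaleH brH h1 hx hd by fact
  interpret M: lie_module scaleH brH smult \<psi> by fact
  interpret L: leibniz_algebra scaleL brL by fact
  note iso = assms(9)
  \<comment> \<open>\<open>F\<close> is the composite of the projection to the quotient with
    \<open>\<phi>\<close>: a surjective homomorphism onto the Heisenberg algebra with kernel
    \<open>leib\<close>.\<close>
  define F where "F x = \<phi> (L.cls x)" for x
  note F_add = L.quot_iso_cls_add[OF iso, folded F_def]
    and F_scale = L.quot_iso_cls_scale[OF iso, folded F_def]
    and F_br = L.quot_iso_cls_br[OF iso, folded F_def]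
    and F_diff = L.quot_iso_cls_diff[OF iso, folded F_def]
    and F_eq = L.quot_iso_cls_eq_iff[OF iso, folded F_def]
    and F_0 = L.quot_iso_cls_eq_0_iff[OF iso, folded F_def]
    and F_surj = L.quot_iso_cls_surj[OF iso, folded F_def]
  obtain T where T: "Vector_Spaces.linear smult scaleL T" "inj T" "range T = L.leib"
    and T_br: "\<And>p x. brL (T p) x = T (\<psi> p (F x))"
    using L.leib_module_iso_inverse[OF iso assms(10) vector_space_smult] unfolding F_def by metis
  interpret T: Vector_Spaces.linear smult scaleL T by fact

  \<comment> \<open>Lifting the Heisenberg basis into the kernel of right multiplication by
    \<open>e1\<close>\<close>
  obtain a1 ax ad where a: "F a1 = h1" "F ax = hx" "F ad = hd"
    using F_surj by metis
  have F_in: "F i = 0" if "i \<in> L.leib" for i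
    using that by (simp add: F_0)
  have br_a1: "brL i a1 = i" if i: "i \<in> L.leib" for i
  proof -
    obtain p where "i = T p"
      using i T(3) by auto
    then show ?thesis
      by (simp add: T_br a assms(4))
  qed
  \<comment> \<open>The square of \<open>a1\<close> lies in \<open>leib\<close>, so it is fixed by
    \<open>a1\<close> from the right and annihilates from the right. Subtracting it keeps the image
    \<open>h1\<close> and makes the square of \<open>e1\<close> vanish.\<close>
  define e1 where "e1 = a1 - brL a1 a1"
  have "brL a1 a1 \<in> L.leib"
    by (rule L.square_in_leib)
  then have F1: "F e1 = h1" and br_e1: "\<And>y. brL y e1 = brL y a1"
    by (simp_all add: e1_def F_diff a F_in L.br_diff_right L.br_leib_right)
  have id: "brL i e1 = i" if "i \<in> L.leib" for i
    using that by (simp add: br_e1 br_a1)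
  \<comment> \<open>When \<open>F y\<close> commutes with \<open>h1\<close>, the product
    \<open>brL y e1\<close> lies in \<open>leib\<close> and is fixed by \<open>e1\<close>, so
    subtracting it moves \<open>y\<close> into the kernel without changing its image.\<close>
  have K: "brL (y - brL y e1) e1 = 0 \<and> F (y - brL y e1) = F y" if "brH (F y) h1 = 0" for y
  proof -
    have "brL y e1 \<in> L.leib"
      using that by (simp add: F1 flip: F_0 add: F_br)
    then show ?thesis
      by (simp add: L.br_diff_left id F_diff F_in)
  qed
  define ex ed where "ex = ax - brL ax e1" and "ed = ad - brL ad e1"
  have Fx: "F ex = hx" and Fd: "F ed = hd" and Kx: "brL ex e1 = 0" and Kd: "brL ed e1 = 0"
    using K[of ax] K[of ad] by (simp_all add: ex_def ed_def a H.br_zero)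
  \<comment> \<open>The correction of \<open>a1\<close> in \<open>K\<close> is \<open>e1\<close>
    itself, because \<open>e1\<close> and \<open>a1\<close> give the same right
    multiplication.\<close>
  have K1: "brL e1 e1 = 0"
    using K[of a1] by (simp add: a H.br_zero br_e1 flip: e1_def)
  have K_eqI: "u = v" if "brL u e1 = 0" "brL v e1 = 0" "F u = F v" for u v
    using L.annihilated_eqI[OF id that(1,2)] that(3) by (simp add: F_eq)
  note K_br = L.br_annihilated_closed[where e = e1]
  have K_0: "brL 0 e1 = 0" and F0: "F 0 = 0"
    by (simp_all add: L.br_0_left F_0 L.subspace_0[OF L.subspace_leib])
  have Km: "brL (- e1) e1 = 0" and Fm: "F (- e1) = - h1"
    using L.br_diff_left[of 0 e1 e1] F_diff[of 0 e1] by (simp_all add: K1 K_0 F0 F1)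
  note KK = Kx Kd K1 K_0 Km F0 F1 Fx Fd Fm F_br H.br_zero H.br_hx_hd H.br_hd_hx
  \<comment> \<open>Both sides are killed by \<open>e1\<close>, so it is enough to compare them
    under \<open>F\<close>, where the Heisenberg table applies.\<close>
  have table: "brL ex ed = e1" "brL ed ex = - e1" "brL e1 ex = 0" "brL e1 ed = 0"
      "brL ex ex = 0" "brL ed ed = 0"
    by (rule K_eqI; simp add: KK K_br)+

  \<comment> \<open>A basis of the ideal and its extension to the whole algebra\<close>
  define X where "X i = T (monom 1 i)" for i
  have X_range: "range X = T ` range (monom 1)"
    by (auto simp: X_def)
  have X_span: "L.span (range X) = L.leib"
    unfolding X_range by (simp add: T.span_image span_monoms T(3))
  have X_ind: "L.independent (range X)"
    unfolding X_range by (rule T.independent_injective_image[OF independent_monoms])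
      (use T(2) in \<open>auto intro: inj_on_subset\<close>)
  have X_inj: "inj X"
    using inj_compose[OF T(2) inj_monom_one] by (simp add: X_def[abs_def] comp_def)
  have X_leib: "X i \<in> L.leib" for i
    using T(3) by (auto simp: X_def)
  have T_expand: "T p = (\<Sum>j\<le>degree p. scaleL (coeff p j) (X j))" for p
  proof -
    have "T p = T (\<Sum>j\<le>degree p. smult (coeff p j) (monom 1 j))"
      by (simp add: smult_monom poly_as_sum_of_monoms)
    then show ?thesis
      by (simp only: T.sum T.scale X_def)
  qed

  \<comment> \<open>\<open>F\<close> kills the span of \<open>X\<close>, so each membership would
    become one of the relations excluded by \<open>basis_not_in_span\<close>.\<close>
  have nd: "ed \<notin> L.span (range X)"
    using H.basis_not_in_span(1) by (simp add: X_span Fd flip: F_0)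
  have nx: "ex \<notin> L.span (insert ed (range X))"
    using H.basis_not_in_span(2)
    by (simp add: L.span_breakdown_eq X_span Fd Fx F_diff F_scale flip: F_0)
  have n1: "e1 \<notin> L.span (insert ex (insert ed (range X)))"
    using H.basis_not_in_span(3)
    by (simp add: L.span_breakdown_eq X_span Fd Fx F1 F_diff F_add F_scale diff_diff_eq flip: F_0)
  have ind: "L.independent (insert e1 (insert ex (insert ed (range X))))"
    using nd nx n1 X_ind by (intro L.independent_insertI)
  have "y \<in> L.span (insert e1 (insert ex (insert ed (range X))))" for y
  proof -
    obtain a b c where "F y = scaleH a h1 + scaleH b hx + scaleH c hd"
      using H.basis_coordinates by blast
    \<comment> \<open>Removing the lifted Heisenberg coordinates leaves an element of
      \<open>leib\<close>, which \<open>X\<close> spans.\<close>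
    then have "F (y - scaleL a e1 - scaleL b ex - scaleL c ed) = 0"
      by (simp add: F_diff F_scale F1 Fx Fd)
    then show ?thesis
      by (auto simp: L.span_breakdown_eq X_span F_0)
  qed
  then have span: "L.span (insert e1 (insert ex (insert ed (range X)))) = UNIV"
    by auto
  have new: "ed \<notin> range X" "ex \<notin> insert ed (range X)" "e1 \<notin> insert ex (insert ed (range X))"
    using nd nx n1 L.span_base by metis+
  then have dist: "distinct [e1, ex, ed]" "{e1, ex, ed} \<inter> range X = {}"
    by auto

  \<comment> \<open>The module law for \<open>brH hx hd = h1\<close> turns into the commutator
    relation, since \<open>h1\<close> acts as the identity.\<close>
  have "\<Omega> ([:0, 1:] * p) = [:0, 1:] * \<Omega> p + p" for p
    using M.act_br[of p hx hd] by (simp only: H.br_hx_hd assms(4-6)) (simp add: algebra_simps)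
  then have "\<exists>c. \<forall>i. \<Omega> (monom 1 i) = smult (of_nat i) (monom 1 (i - 1)) + monom 1 i * c"
    using commutator_one_on_monoms by blast
  moreover have "brL (X i) ex = X (i + 1)" for i
    by (simp add: X_def T_br Fx assms(5) monom_Suc)
  moreover have "brL (X i) ed =
      (\<Sum>j\<le>degree (\<Omega> (monom 1 i)). scaleL (coeff (\<Omega> (monom 1 i)) j) (X j))" for i
    by (simp add: T_expand[symmetric]) (simp add: X_def T_br Fd assms(6))
  moreover have "{e1, ex, ed} \<union> range X = insert e1 (insert ex (insert ed (range X)))"
    by auto
  ultimately show ?thesis
    using dist X_inj ind span X_span table K1 Kx Kd id[OF X_leib] L.br_leib_right[OF X_leib]
    by (intro exI[of _ e1] exI[of _ ex] exI[of _ ed] exI[of _ X] conjI) (simp_all only: simp_thms)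
qed

end
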